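(* Let $R$ be a euclidean ring, let $n\geq 6$ and let $\Gamma=SL_n(R)$. Then every quasi-homomorphism $\psi\colon\Gamma\to\mathbb{R}$ is bounded. Equivalently, the stable commutator length vanishes identically on $[\Gamma,\Gamma]$.
   Context: A euclidean ring is a commutative integral domain with unit admitting a euclidean function (division with remainder). $SL_n(R)$ is the group of $n\times n$ matrices over $R$ of determinant $1$. A quasi-homomorphism on a group $\Gamma$ is a function $\psi\colon\Gamma\to\mathbb{R}$ with $\sup_{g,h\in\Gamma}|\psi(gh)-\psi(g)-\psi(h)|<\infty$. For $g\in[\Gamma,\Gamma]$, $\mathrm{cl}(g)$ is the least number of commutators whose product is $g$ ($\mathrm{cl}(e)=0$), and the stable commutator length is $\mathrm{scl}(g)=\lim_{k\to\infty}\mathrm{cl}(g^k)/k$. *)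

theory Defs
  imports "HOL-Analysis.Analysis"
begin

definition SL :: "('a::comm_ring_1^'n^'n) set" where
  "SL = {A. det A = 1}"

definition quasi_hom_SL :: "('a::comm_ring_1^'n^'n \<Rightarrow> real) \<Rightarrow> bool" where
  "quasi_hom_SL \<psi> \<longleftrightarrow>
     (\<exists>C. \<forall>g\<in>SL. \<forall>h\<in>SL. \<bar>\<psi> (g ** h) - \<psi> g - \<psi> h\<bar> \<le> C)"

definition commutator_SL :: "('a::comm_ring_1^'n^'n) set" where
  "commutator_SL = {g ** h ** matrix_inv g ** matrix_inv h | g h. g \<in> SL \<and> h \<in> SL}"

fun comm_prods :: "nat \<Rightarrow> ('a::comm_ring_1^'n^'n) set" where
  "comm_prods 0 = {mat 1}"
| "comm_prods (Suc k) = {x ** c | x c. x \<in> comm_prods k \<and> c \<in> commutator_SL}"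

definition comm_subgroup_SL :: "('a::comm_ring_1^'n^'n) set" where
  "comm_subgroup_SL = (\<Union>k. comm_prods k)"

definition cl_SL :: "('a::comm_ring_1^'n^'n) \<Rightarrow> nat" where
  "cl_SL g = (LEAST k. g \<in> comm_prods k)"

fun mpow :: "('a::comm_ring_1^'n^'n) \<Rightarrow> nat \<Rightarrow> 'a^'n^'n" where
  "mpow g 0 = mat 1"
| "mpow g (Suc k) = g ** mpow g k"

end

theory Submission
  imports Defs
begin

text \<open>Count a matrix as small if it is a product of boundedly many commutators. Up to a bounded error,
  an element of the special linear group is a \<open>2 \<times> 2\<close> block, and such a block is determined by its
  first row \<open>(a, b)\<close>; the resulting symbol \<open>[a, b]\<close> is symmetric, bimultiplicative and invariant
  under \<open>b \<mapsto> b + t a\<close>, each time up to a bounded error. Hence the \<open>N\<cdot>N\<close>-th power of \<open>[a, b]\<close>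
  is \<open>[a\<^sup>N, b\<^sup>N]\<close> up to an error of order \<open>N\<cdot>N\<close>, while a step of the Euclidean algorithm
  changes \<open>[a\<^sup>N, b\<^sup>N]\<close> only by an error of order \<open>N\<close>. Taking \<open>N\<close> larger than the number of steps
  shows that some positive power \<open>g\<^sup>k\<close> is a product of \<open>C k\<close> commutators, with \<open>C\<close> independent of
  \<open>g\<close>. A quasi-homomorphism is therefore bounded, and since the stable commutator length is bounded
  and homogeneous, it vanishes.\<close>

subsection \<open>Inverses in the special linear group\<close>

text \<open>Laplace expansion along row \<open>i\<close>; the cofactors are written as determinants
  in which row \<open>i\<close> is a unit vector.\<close>

lemma det_replace_row:
  fixes A :: "'a::comm_ring_1^'n^'n"
  shows "det (\<chi> k. if k = i then v else A$k)
    = (\<Sum>j\<in>UNIV. v$j * det (\<chi> k. if k = i then axis j 1 else A$k))"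
proof -
  have "det (\<chi> k. if k = i then v else A$k)
      = det (\<chi> k. if k = i then (\<Sum>j\<in>UNIV. v$j *s axis j 1) else A$k)"
    unfolding basis_expansion ..
  also have "\<dots> = (\<Sum>j\<in>UNIV. det (\<chi> k. if k = i then v$j *s axis j 1 else A$k))"
    by (rule det_linear_row_sum) simp
  also have "\<dots> = (\<Sum>j\<in>UNIV. v$j * det (\<chi> k. if k = i then axis j 1 else A$k))"
    by (simp add: det_row_mul)
  finally show ?thesis .
qed

text \<open>Cramer's rule: for the adjugate \<open>B\<close>, the entry of \<open>A ** B\<close> at
  \<open>(l, i)\<close> is the determinant of \<open>A\<close> with row \<open>i\<close> overwritten
  by row \<open>l\<close>. This is \<open>det A\<close> on the diagonal; elsewhere two rows
  coincide.\<close>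

lemma ex_adjugate:
  fixes A :: "'a::comm_ring_1^'n^'n"
  shows "\<exists>B. A ** B = mat (det A)"
proof -
  define B :: "'a^'n^'n" where "B = (\<chi> j i. det (\<chi> k. if k = i then axis j 1 else A$k))"
  have "(A ** B)$l$i = mat (det A)$l$i" for l i
  proof -
    have "(A ** B)$l$i = det (\<chi> k. if k = i then A$l else A$k)"
      by (simp add: matrix_matrix_mult_def B_def det_replace_row[of i "A$l"])
    also have "\<dots> = mat (det A)$l$i"
    proof (cases "l = i")
      case True
      then have "(\<chi> k. if k = i then A$l else A$k) = A"
        by (simp add: vec_eq_iff)
      then show ?thesis using True by (simp add: mat_def)
    next
      case False
      then show ?thesis
        by (simp add: mat_def det_identical_rows[of l i] row_def)
    qed
    finally show ?thesis .
  qed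
  then show ?thesis by (auto simp: vec_eq_iff)
qed

lemma SL_one [simp]: "mat 1 \<in> SL"
  by (simp add: SL_def)

lemma SL_mult [simp]: "A \<in> SL \<Longrightarrow> B \<in> SL \<Longrightarrow> A ** B \<in> SL"
  by (simp add: SL_def det_mul)

text \<open>The adjugates of \<open>A\<close> and of its transpose give a right and a left inverse,
  which agree. Both sides matter because \<open>matrix_inv\<close> chooses a two-sided
  inverse.\<close>

lemma SL_inverse:
  fixes A :: "'a::comm_ring_1^'n^'n"
  assumes "A \<in> SL"
  shows "A ** matrix_inv A = mat 1 \<and> matrix_inv A ** A = mat 1"
proof -
  have "det A = 1" using assms by (simp add: SL_def)
  then obtain B where B: "A ** B = mat 1" using ex_adjugate[of A] by auto
  obtain C where C: "transpose A ** C = mat 1"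
    using ex_adjugate[of "transpose A"] \<open>det A = 1\<close> by auto
  have "transpose C ** A = mat 1"
    using C by (metis matrix_transpose_mul transpose_mat transpose_transpose)
  then have "B ** A = mat 1"
    using B by (metis matrix_mul_assoc matrix_mul_lid matrix_mul_rid)
  then show ?thesis
    unfolding matrix_inv_def using B by (metis (mono_tags, lifting) someI_ex)
qed

lemma SL_inv_right [simp]: "A \<in> SL \<Longrightarrow> A ** matrix_inv A = mat 1"
  and SL_inv_left [simp]: "A \<in> SL \<Longrightarrow> matrix_inv A ** A = mat 1"
  using SL_inverse by blast+

lemma SL_inv_right_assoc [simp]: "A \<in> SL \<Longrightarrow> A ** (matrix_inv A ** B) = B"
  and SL_inv_left_assoc [simp]: "A \<in> SL \<Longrightarrow> matrix_inv A ** (A ** B) = B"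
  by (simp_all add: matrix_mul_assoc)

lemma SL_inv [simp]: "A \<in> SL \<Longrightarrow> matrix_inv A \<in> SL"
  using SL_inv_right[of A] unfolding SL_def by (metis (mono_tags) det_I det_mul mem_Collect_eq mult_1)

lemma matrix_inv_eqI:
  assumes "A \<in> SL" "A ** B = mat 1"
  shows "matrix_inv A = B"
  using assms by (metis SL_inv_left matrix_mul_assoc matrix_mul_lid matrix_mul_rid)

lemma matrix_inv_inv [simp]: "A \<in> SL \<Longrightarrow> matrix_inv (matrix_inv A) = A"
  by (simp add: matrix_inv_eqI)

lemma matrix_inv_one [simp]: "matrix_inv (mat 1 :: 'a::comm_ring_1^'n^'n) = mat 1"
  by (simp add: matrix_inv_eqI)

lemma matrix_inv_mult:
  "A \<in> SL \<Longrightarrow> B \<in> SL \<Longrightarrow> matrix_inv (A ** B) = matrix_inv B ** matrix_inv A"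
  by (rule matrix_inv_eqI) (simp_all add: matrix_mul_assoc[symmetric])

lemma mpow_SL [simp]: "g \<in> SL \<Longrightarrow> mpow g k \<in> SL"
  by (induction k) auto

lemma mpow_add: "mpow g (i + j) = mpow g i ** mpow g j"
  by (induction i) (auto simp: matrix_mul_assoc)

lemma mpow_mult: "mpow g (i * j) = mpow (mpow g i) j"
  by (induction j) (auto simp: mpow_add)

subsection \<open>Products of commutators\<close>

lemma commutator_SL_mem: "g \<in> SL \<Longrightarrow> h \<in> SL \<Longrightarrow> g ** h ** matrix_inv g ** matrix_inv h \<in> commutator_SL"
  by (auto simp: commutator_SL_def)

lemma commutator_SL_subset: "c \<in> commutator_SL \<Longrightarrow> c \<in> SL"
  by (auto simp: commutator_SL_def)

lemma one_commutator_SL: "mat 1 \<in> commutator_SL"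
  using commutator_SL_mem[of "mat 1" "mat 1"] by simp

lemma commutator_SL_conj:
  assumes "g \<in> SL" "c \<in> commutator_SL"
  shows "g ** c ** matrix_inv g \<in> commutator_SL"
proof -
  from assms(2) obtain x y where xy: "x \<in> SL" "y \<in> SL"
    "c = x ** y ** matrix_inv x ** matrix_inv y"
    by (auto simp: commutator_SL_def)
  let ?c = "\<lambda>x. g ** x ** matrix_inv g"
  have "g ** c ** matrix_inv g = ?c x ** ?c y ** matrix_inv (?c x) ** matrix_inv (?c y)"
    using assms(1) xy by (simp add: matrix_inv_mult matrix_mul_assoc[symmetric])
  then show ?thesis using commutator_SL_mem[of "?c x" "?c y"] assms(1) xy by simp
qed

lemma commutator_SL_inv: "c \<in> commutator_SL \<Longrightarrow> matrix_inv c \<in> commutator_SL"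
proof -
  assume "c \<in> commutator_SL"
  then obtain x y where xy: "x \<in> SL" "y \<in> SL"
    "c = x ** y ** matrix_inv x ** matrix_inv y"
    by (auto simp: commutator_SL_def)
  then have "matrix_inv c = y ** x ** matrix_inv y ** matrix_inv x"
    by (simp add: matrix_inv_mult matrix_mul_assoc[symmetric])
  then show ?thesis using commutator_SL_mem[of y x] xy by simp
qed

lemma comm_prods_subset: "x \<in> comm_prods k \<Longrightarrow> x \<in> SL"
  by (induction k arbitrary: x) (auto simp: commutator_SL_subset)

lemma one_comm_prods [simp]: "(mat 1 :: 'a::comm_ring_1^'n^'n) \<in> comm_prods k"
proof (induction k)
  case (Suc k)
  then show ?case
    by (auto intro!: exI[of _ "mat 1"] one_commutator_SL)
qed simp

lemma comm_prods_mult: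
  "x \<in> comm_prods i \<Longrightarrow> y \<in> comm_prods j \<Longrightarrow> x ** y \<in> comm_prods (i + j)"
proof (induction j arbitrary: y)
  case (Suc j)
  from Suc.prems(2) obtain z c where "z \<in> comm_prods j" "c \<in> commutator_SL" "y = z ** c"
    by auto
  then show ?case
    using Suc.IH[OF Suc.prems(1), of z] by (auto simp: matrix_mul_assoc)
qed auto

lemma comm_prods_mono: "x \<in> comm_prods i \<Longrightarrow> i \<le> j \<Longrightarrow> x \<in> comm_prods j"
  using comm_prods_mult[of x i "mat 1" "j - i"] by simp

lemma comm_prods_commutator: "c \<in> commutator_SL \<Longrightarrow> c \<in> comm_prods 1"
  by (metis (mono_tags, lifting) One_nat_def comm_prods.simps matrix_mul_lid mem_Collect_eq singletonI)

lemma comm_prods_conj: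
  "g \<in> SL \<Longrightarrow> x \<in> comm_prods i \<Longrightarrow> g ** x ** matrix_inv g \<in> comm_prods i"
proof (induction i arbitrary: x)
  case (Suc i)
  from Suc.prems(2) obtain z c where zc: "z \<in> comm_prods i" "c \<in> commutator_SL" "x = z ** c"
    by auto
  have "g ** x ** matrix_inv g = (g ** z ** matrix_inv g) ** (g ** c ** matrix_inv g)"
    using zc Suc.prems by (simp add: matrix_mul_assoc[symmetric])
  then show ?case
    using Suc.IH[OF Suc.prems(1) zc(1)] commutator_SL_conj[OF Suc.prems(1) zc(2)] by auto
qed auto

lemma comm_prods_inv: "x \<in> comm_prods i \<Longrightarrow> matrix_inv x \<in> comm_prods i"
proof (induction i arbitrary: x)
  case (Suc i)
  from Suc.prems obtain z c where zc: "z \<in> comm_prods i" "c \<in> commutator_SL" "x = z ** c"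
    by auto
  then have "matrix_inv x = matrix_inv c ** matrix_inv z"
    using comm_prods_subset[OF zc(1)] commutator_SL_subset[OF zc(2)] by (simp add: matrix_inv_mult)
  then show ?case
    using comm_prods_mult[OF comm_prods_commutator[OF commutator_SL_inv[OF zc(2)]] Suc.IH[OF zc(1)]]
    by simp
qed auto

lemma comm_prods_mpow: "x \<in> comm_prods i \<Longrightarrow> mpow x k \<in> comm_prods (k * i)"
  by (induction k) (auto simp: comm_prods_mult)

declare comm_prods.simps(2) [simp del]

subsection \<open>The commutator pseudometric\<close>

text \<open>Distance at most \<open>k\<close> in the word metric whose generators are the
  commutators. Carrying an upper bound avoids least values throughout.\<close>

definition near :: "nat \<Rightarrow> 'a::comm_ring_1^'n^'n \<Rightarrow> 'a^'n^'n \<Rightarrow> bool" where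
  "near k X Y \<longleftrightarrow> X \<in> SL \<and> Y \<in> SL \<and> X ** matrix_inv Y \<in> comm_prods k"

lemma near_SL: "near k X Y \<Longrightarrow> X \<in> SL" "near k X Y \<Longrightarrow> Y \<in> SL"
  by (auto simp: near_def)

lemma near_refl [simp]: "X \<in> SL \<Longrightarrow> near k X X"
  by (simp add: near_def)

lemma near_mono: "near i X Y \<Longrightarrow> i \<le> j \<Longrightarrow> near j X Y"
  by (auto simp: near_def intro: comm_prods_mono)

lemma near_sym: "near k X Y \<Longrightarrow> near k Y X"
  using comm_prods_inv[of "X ** matrix_inv Y" k] by (auto simp: near_def matrix_inv_mult)

lemma near_trans: "near i X Y \<Longrightarrow> near j Y Z \<Longrightarrow> near (i + j) X Z"
  using comm_prods_mult[of "X ** matrix_inv Y" i "Y ** matrix_inv Z" j]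
  by (auto simp: near_def matrix_mul_assoc[symmetric])

text \<open>The error of the second factor appears conjugated by the first, and conjugates need no
  more commutators, so errors simply add.\<close>

lemma near_mult:
  assumes "near i X X'" "near j Y Y'"
  shows "near (i + j) (X ** Y) (X' ** Y')"
proof -
  have S: "X \<in> SL" "X' \<in> SL" "Y \<in> SL" "Y' \<in> SL"
    using assms by (auto simp: near_def)
  have "(X ** Y) ** matrix_inv (X' ** Y')
      = (X ** (Y ** matrix_inv Y') ** matrix_inv X) ** (X ** matrix_inv X')"
    using S by (simp add: matrix_inv_mult matrix_mul_assoc[symmetric])
  moreover have "X ** (Y ** matrix_inv Y') ** matrix_inv X \<in> comm_prods j"
    using assms S by (intro comm_prods_conj) (auto simp: near_def)
  moreover have "X ** matrix_inv X' \<in> comm_prods i"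
    using assms by (auto simp: near_def)
  ultimately have "(X ** Y) ** matrix_inv (X' ** Y') \<in> comm_prods (j + i)"
    by (metis comm_prods_mult)
  then show ?thesis using S by (simp add: near_def add.commute)
qed

lemma near_mpow: "near c X Y \<Longrightarrow> near (k * c) (mpow X k) (mpow Y k)"
  by (induction k) (auto intro: near_mult)

text \<open>The quotient is the commutator of \<open>P\<close> and \<open>X\<close>: a change of
  basis costs 1, whatever \<open>P\<close> is.\<close>

lemma near_conj:
  assumes "P \<in> SL" "X \<in> SL"
  shows "near 1 (P ** X ** matrix_inv P) X"
  using assms comm_prods_commutator[OF commutator_SL_mem[of P X]] by (simp add: near_def)

lemma near_one_iff: "near k X (mat 1) \<longleftrightarrow> X \<in> comm_prods k"
  by (auto simp: near_def comm_prods_subset)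

lemma near_mult_left: "e \<in> comm_prods m \<Longrightarrow> X \<in> SL \<Longrightarrow> near m (e ** X) X"
  using near_mult[of m e "mat 1" 0 X X] by (simp add: near_one_iff)

lemma near_mult_right: "e \<in> comm_prods m \<Longrightarrow> X \<in> SL \<Longrightarrow> near m (X ** e) X"
  using near_mult[of 0 X X m e "mat 1"] by (simp add: near_one_iff)

subsection \<open>Elementary matrices\<close>

definition elem :: "'n \<Rightarrow> 'n \<Rightarrow> 'a::comm_ring_1 \<Rightarrow> 'a^'n^'n" where
  "elem i j x = (\<chi> k l. mat 1$k$l + (if k = i \<and> l = j then x else 0))"

lemma elem_mult: "(elem i j x ** A)$k$l = A$k$l + (if k = i then x * A$j$l else 0)"
  by (simp add: elem_def matrix_matrix_mult_def mat_def distrib_right sum.distrib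
      if_distrib[of "\<lambda>z. z * _"] cong: if_cong)

lemma mult_elem: "(A ** elem i j x)$k$l = A$k$l + (if l = j then A$k$i * x else 0)"
  by (simp add: elem_def matrix_matrix_mult_def mat_def distrib_left sum.distrib
      if_distrib[of "\<lambda>z. _ * z"] if_distrib[of "\<lambda>z. z * _"] cong: if_cong)

lemma elem_SL [simp]: "i \<noteq> j \<Longrightarrow> elem i j x \<in> SL"
proof -
  assume "i \<noteq> j"
  have "elem i j x = (\<chi> k. if k = i then row i (mat 1) + x *s row j (mat 1) else row k (mat 1))"
    by (auto simp: elem_def vec_eq_iff row_def mat_def)
  then show ?thesis
    using det_row_operation[OF \<open>i \<noteq> j\<close>, of "mat 1" x] by (simp add: SL_def)
qed

lemma matrix_inv_elem: "i \<noteq> j \<Longrightarrow> matrix_inv (elem i j x) = elem i j (- x)"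
  by (rule matrix_inv_eqI) (auto simp: vec_eq_iff elem_mult, auto simp: elem_def mat_def)

text \<open>Steinberg relation: \<open>elem i j x\<close> is the commutator of
  \<open>elem i k x\<close> and \<open>elem k j 1\<close>. Dimension 3 provides the extra index
  \<open>k\<close>.\<close>

lemma elem_comm_prods:
  fixes i j :: "'n::finite"
  assumes "i \<noteq> j" "CARD('n) \<ge> 3"
  shows "elem i j x \<in> comm_prods 1"
proof -
  have "\<not> UNIV \<subseteq> {i, j}"
    using assms card_mono[of "{i, j}" "UNIV :: 'n set"] by (auto simp: card_insert_if)
  then obtain k where k: "k \<noteq> i" "k \<noteq> j" by auto
  have "elem i j x
      = elem i k x ** elem k j 1 ** matrix_inv (elem i k x) ** matrix_inv (elem k j 1)"
    using k assms(1)
    by (auto simp: vec_eq_iff matrix_inv_elem matrix_mul_assoc[symmetric] elem_mult)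
       (auto simp: elem_def mat_def)
  then show ?thesis
    using k comm_prods_commutator[OF commutator_SL_mem[of "elem i k x" "elem k j 1"]] by simp
qed

subsection \<open>Mennicke symbols up to bounded error\<close>

text \<open>Comaximality, that is, \<open>(a, b)\<close> is the first row of some
  \<open>2 \<times> 2\<close> matrix of determinant 1.\<close>

definition comax :: "'a::comm_ring_1 \<Rightarrow> 'a \<Rightarrow> bool" where
  "comax a b \<longleftrightarrow> (\<exists>x y. x * a + y * b = 1)"

lemma comax_sym: "comax a b \<Longrightarrow> comax b a"
  unfolding comax_def by (metis add.commute)

lemma comax_one [simp]: "comax a 1"
  unfolding comax_def by (rule exI[of _ 0], rule exI[of _ 1]) simp

lemma comax_mult:
  assumes "comax a b" "comax a c"
  shows "comax a (b * c)"
proof -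
  obtain x y u v where "x * a + y * b = 1" "u * a + v * c = 1"
    using assms by (auto simp: comax_def)
  moreover have "(x + y * b * u) * a + (y * v) * (b * c) = x * a + y * b * (u * a + v * c)"
    by (simp add: algebra_simps)
  ultimately have "(x + y * b * u) * a + (y * v) * (b * c) = 1" by simp
  then show ?thesis by (auto simp: comax_def)
qed

lemma comax_power: "comax a b \<Longrightarrow> comax a (b ^ k)"
  by (induction k) (auto intro: comax_mult)

lemma comax_power2: "comax a b \<Longrightarrow> comax (a ^ i) (b ^ j)"
  by (rule comax_power, rule comax_sym, rule comax_power, rule comax_sym)

lemma comax_add:
  assumes "comax a b"
  shows "comax a (b + t * a)"
proof -
  obtain x y where "x * a + y * b = 1" using assms by (auto simp: comax_def)
  then have "(x - y * t) * a + y * (b + t * a) = 1" by (simp add: algebra_simps)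
  then show ?thesis by (auto simp: comax_def)
qed

text \<open>The block sits in dimension 3 because there every elementary matrix is a
  commutator.\<close>

definition blk :: "'a::comm_ring_1 \<Rightarrow> 'a \<Rightarrow> 'a \<Rightarrow> 'a \<Rightarrow> 'a^3^3" where
  "blk a b c d = vector [vector [a, b, 0], vector [c, d, 0], vector [0, 0, 1]]"

lemma det_blk: "det (blk a b c d) = a * d - b * c"
  by (simp add: blk_def det_3 vector_3)

lemma blk_SL: "a * d - b * c = 1 \<Longrightarrow> blk a b c d \<in> SL"
  by (simp add: SL_def det_blk)

lemma elem3 [simp]: "(i::3) \<noteq> j \<Longrightarrow> elem i j x \<in> comm_prods (Suc 0)"
  using elem_comm_prods[of i j x] by simp

lemma elem3_mult: "(i::3) \<noteq> j \<Longrightarrow> X \<in> comm_prods k \<Longrightarrow> elem i j x ** X \<in> comm_prods (Suc k)"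
  using comm_prods_mult[OF elem3, of i j X k x] by simp

text \<open>Two completions of the same first row differ by one elementary row operation;
  \<open>?x\<close> is the lower left entry of their quotient.\<close>

lemma near_blk:
  assumes "a * d - b * c = 1" "a * d' - b * c' = 1"
  shows "near 1 (blk a b c' d') (blk a b c d)"
proof -
  let ?x = "c' * d - d' * c"
  have "c' = c + ?x * a" "d' = d + ?x * b"
  proof -
    have "c + ?x * a = c + c' * (a * d - b * c) - c * (a * d' - b * c')"
      by (simp add: algebra_simps)
    then show "c' = c + ?x * a" using assms by simp
    have "d + ?x * b = d + d' * (a * d - b * c) - d * (a * d' - b * c')"
      by (simp add: algebra_simps)
    then show "d' = d + ?x * b" using assms by simp
  qed
  then have "blk a b c' d' = elem 2 1 ?x ** blk a b c d"
    by (simp add: vec_eq_iff forall_3 elem_mult blk_def vector_3)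
  then show ?thesis
    using near_mult_left[of "elem 2 1 ?x" 1 "blk a b c d"] blk_SL[OF assms(1)] by simp
qed

text \<open>Up to one commutator this depends only on the first row, so it plays the role of the
  Mennicke symbol of \<open>a\<close> and \<open>b\<close>.\<close>

definition msym :: "'a::comm_ring_1 \<Rightarrow> 'a \<Rightarrow> 'a^3^3" where
  "msym a b = (SOME g. \<exists>c d. a * d - b * c = 1 \<and> g = blk a b c d)"

lemma msym_blk:
  assumes "comax a b"
  obtains c d where "a * d - b * c = 1" "msym a b = blk a b c d"
proof -
  obtain x y where "x * a + y * b = 1" using assms by (auto simp: comax_def)
  then have "a * x - b * (- y) = 1" by (simp add: mult.commute)
  then have "\<exists>g. \<exists>c d. a * d - b * c = 1 \<and> g = blk a b c d" by blast
  then have "\<exists>c d. a * d - b * c = 1 \<and> msym a b = blk a b c d"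
    unfolding msym_def by (rule someI_ex)
  then show ?thesis using that by blast
qed

lemma msym_SL: "comax a b \<Longrightarrow> msym a b \<in> SL"
  by (metis msym_blk blk_SL)

lemma near_blk_msym: "a * d - b * c = 1 \<Longrightarrow> near 1 (blk a b c d) (msym a b)"
proof -
  assume *: "a * d - b * c = 1"
  then have "d * a + (- c) * b = 1" by (simp add: algebra_simps)
  then have "comax a b" unfolding comax_def by blast
  then show ?thesis using near_blk * by (metis msym_blk)
qed

text \<open>An elementary column operation performs the shift at cost 1; passing to the chosen
  completion costs 1 more.\<close>

lemma msym_add:
  assumes "comax a b"
  shows "near 2 (msym a (b + t * a)) (msym a b)"
proof -
  obtain c d where cd: "a * d - b * c = 1" "msym a b = blk a b c d"
    using assms by (rule msym_blk)
  have det: "a * (d + t * c) - (b + t * a) * c = 1"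
    using cd(1) by (simp add: algebra_simps)
  have "blk a b c d ** elem 1 2 t = blk a (b + t * a) c (d + t * c)"
    by (simp add: vec_eq_iff forall_3 mult_elem blk_def vector_3 mult.commute)
  then have "near 1 (blk a (b + t * a) c (d + t * c)) (msym a b)"
    using near_mult_right[of "elem 1 2 t" 1 "blk a b c d"] blk_SL[OF cd(1)] cd(2) by simp
  then show ?thesis
    using near_trans[OF near_sym[OF near_blk_msym[OF det]]] by (simp add: numeral_2_eq_2)
qed

text \<open>The Weyl element \<open>J\<close>, a product of three elementary matrices, turns
  \<open>(a, b)\<close> into \<open>(b, - a)\<close>. Conjugation by \<open>D\<close> corrects the
  sign; the third coordinate lets \<open>D\<close> have determinant 1.\<close>

lemma msym_swap:
  assumes "comax a b"
  shows "near 5 (msym b a) (msym a b)"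
proof -
  obtain c d where cd: "a * d - b * c = 1" "msym a b = blk a b c d"
    using assms by (rule msym_blk)
  define J :: "'a^3^3" where "J = elem 2 1 1 ** (elem 1 2 (- 1) ** elem 2 1 1)"
  define D :: "'a^3^3" where
    "D = vector [vector [1, 0, 0], vector [0, - 1, 0], vector [0, 0, - 1]]"
  have J: "J \<in> comm_prods 3"
    unfolding J_def by (simp add: eval_nat_numeral elem3_mult)
  have J': "blk a b c d ** J = blk b (- a) d (- c)"
    unfolding J_def matrix_mul_assoc
    by (simp add: vec_eq_iff forall_3 mult_elem blk_def vector_3)
  have D: "D \<in> SL" by (simp add: SL_def D_def det_3 vector_3)
  have "D ** D = mat 1"
    by (simp add: vec_eq_iff forall_3 D_def matrix_matrix_mult_def sum_3 vector_3 mat_def)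
  then have "matrix_inv D = D" using D by (simp add: matrix_inv_eqI)
  then have conj: "D ** blk b (- a) d (- c) ** matrix_inv D = blk b a (- d) (- c)"
    by (simp add: vec_eq_iff forall_3 D_def blk_def matrix_matrix_mult_def sum_3 vector_3)
  have det: "b * (- c) - a * (- d) = 1" "b * (- c) - (- a) * d = 1"
    using cd(1) by (simp_all add: algebra_simps)
  have "near 1 (blk b a (- d) (- c)) (blk b (- a) d (- c))"
    using near_conj[OF D blk_SL[OF det(2)]] conj by simp
  moreover have "near 3 (blk b (- a) d (- c)) (msym a b)"
    using near_mult_right[OF J blk_SL[OF cd(1)]] J' cd(2) by simp
  ultimately have "near (1 + (1 + 3)) (msym b a) (msym a b)"
    using near_sym[OF near_blk_msym[OF det(1)]] near_trans by blast
  then show ?thesis by simp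
qed

text \<open>The third row and column give room: multiplying \<open>(a, b, 0)\<close> by a block in the last two
  coordinates with first row \<open>(b', - a)\<close>, a conjugate of \<open>[a, b']\<close> up to elementary factors, yields
  \<open>(a, b b', - a b)\<close>. Clearing the last entry creates a \<open>- 1\<close> in the second row, which allows the
  remaining block to be reduced explicitly.\<close>

lemma msym_mult:
  assumes "comax a b" "comax a b'"
  shows "near 12 (msym a (b * b')) (msym a b ** msym a b')"
proof -
  obtain c d where cd: "a * d - b * c = 1" "msym a b = blk a b c d"
    using assms(1) by (rule msym_blk)
  obtain c' d' where cd': "a * d' - b' * c' = 1" "msym a b' = blk a b' c' d'"
    using assms(2) by (rule msym_blk)
  let ?A = "blk a b c d" and ?A' = "blk a b' c' d'"
  define P :: "'a^3^3" where
    "P = vector [vector [0, 0, 1], vector [1, 0, 0], vector [0, 1, 0]]"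
  define Q :: "'a^3^3" where
    "Q = vector [vector [0, 1, 0], vector [0, 0, 1], vector [1, 0, 0]]"
  define N :: "'a^3^3" where
    "N = vector [vector [1, 0, 0], vector [0, a, b'], vector [0, c', d']]"
  \<comment> \<open>After \<open>R\<close> the second row is \<open>(0, 0, - 1)\<close>. The
    rightmost factor of \<open>L\<close> uses it to clear the last entry of the third row; the other
    three rotate the last two rows.\<close>
  define L :: "'a^3^3" where
    "L = elem 3 2 (- 1) ** (elem 2 3 1 ** (elem 3 2 (- 1) ** elem 3 2 (- c')))"
  \<comment> \<open>The first three factors rotate the last two columns, \<open>elem 1 3 b\<close>
    clears the last entry of the first row, and the remaining two use the resulting
    \<open>- 1\<close> to clear the rest of the second row.\<close>
  define R :: "'a^3^3" where
    "R = elem 3 2 1 ** (elem 2 3 (- 1) ** (elem 3 2 1 ** (elem 1 3 b ** (elem 3 1 c ** elem 3 2 (d * b')))))"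
  have L: "L \<in> comm_prods 4"
    unfolding L_def by (simp add: eval_nat_numeral elem3_mult)
  have R: "R \<in> comm_prods 6"
    unfolding R_def by (simp add: eval_nat_numeral elem3_mult)
  have P: "P \<in> SL" by (simp add: SL_def P_def det_3 vector_3)
  have "P ** Q = mat 1"
    by (simp add: vec_eq_iff forall_3 P_def Q_def matrix_matrix_mult_def sum_3 vector_3 mat_def)
  then have "matrix_inv P = Q" using P by (simp add: matrix_inv_eqI)
  then have "P ** ?A' ** matrix_inv P = N"
    by (simp add: vec_eq_iff forall_3 P_def Q_def N_def blk_def matrix_matrix_mult_def sum_3 vector_3)
  then have N: "near 1 N ?A'"
    using near_conj[OF P blk_SL[OF cd'(1)]] by simp
  have AN: "?A ** N = vector [vector [a, b * a, b * b'], vector [c, d * a, d * b'], vector [0, c', d']]"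
    by (simp add: vec_eq_iff forall_3 N_def blk_def matrix_matrix_mult_def sum_3 vector_3)
  have e: "d * a = 1 + b * c" using cd(1) by (simp add: algebra_simps)
  then have e': "a * d = 1 + b * c" by (simp add: mult.commute)
  \<comment> \<open>The relation \<open>a * d = 1 + b * c\<close> as rewrite rules for monomials in
    which other factors separate \<open>a\<close> from \<open>d\<close>.\<close>
  have ad: "a * (x * d) = x * (1 + b * c)" "a * (x * (y * d)) = x * (y * (1 + b * c))"
    "a * (x * (y * (z * d))) = x * (y * (z * (1 + b * c)))" for x y z
    unfolding e'[symmetric] by (simp_all add: algebra_simps)
  have eq: "L ** ((?A ** N) ** R) = blk a (b * b') (- (c * c')) (d' - c' * d * b')"
    unfolding AN L_def R_def matrix_mul_assoc[symmetric]
    by (simp add: vec_eq_iff forall_3 elem_mult)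
       (simp add: matrix_mul_assoc mult_elem vector_3 blk_def e' ad algebra_simps)
  have S: "?A ** N \<in> SL" using blk_SL[OF cd(1)] near_SL[OF N] by simp
  have "near 4 (L ** ((?A ** N) ** R)) ((?A ** N) ** R)"
    using S comm_prods_subset[OF R] by (intro near_mult_left L) simp
  moreover have "near 6 ((?A ** N) ** R) (?A ** N)" by (rule near_mult_right[OF R S])
  moreover have "near (0 + 1) (?A ** N) (?A ** ?A')"
    by (intro near_mult N near_refl blk_SL cd(1))
  ultimately have "near (4 + (6 + (0 + 1))) (L ** ((?A ** N) ** R)) (?A ** ?A')"
    by (blast intro: near_trans)
  then have n: "near 11 (L ** ((?A ** N) ** R)) (?A ** ?A')" by simp
  have "a * (d' - c' * d * b') - (b * b') * (- (c * c'))
      = (a * d' - b' * c') - b' * c' * (a * d - b * c - 1)"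
    by (simp add: algebra_simps)
  then have "a * (d' - c' * d * b') - (b * b') * (- (c * c')) = 1"
    using cd(1) cd'(1) by simp
  from near_trans[OF near_sym[OF near_blk_msym[OF this]] n[unfolded eq]]
  show ?thesis using cd(2) cd'(2) by simp
qed

section \<open>Symbols of powers and the Euclidean algorithm\<close>

text \<open>After a swap, \<open>a\<close> is a multiple of the first entry 1 and can be shifted to
  0; the row \<open>(1, 0)\<close> is completed by the identity.\<close>

lemma msym_one_right: "near 8 (msym a 1) (mat 1)"
proof -
  have "near 5 (msym a 1) (msym 1 a)"
    using comax_sym[OF comax_one] by (rule msym_swap)
  moreover have "near 2 (msym 1 a) (msym 1 0)"
    using msym_add[OF comax_sym[OF comax_one], of 0 a] by simp
  moreover have "near 1 (msym 1 0) (blk 1 0 0 1 :: 'a^3^3)"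
    by (rule near_sym, rule near_blk_msym) simp
  ultimately have "near (5 + (2 + 1)) (msym a 1) (blk 1 0 0 1)"
    by (blast intro: near_trans)
  moreover have "blk 1 0 0 1 = (mat 1 :: 'a^3^3)"
    by (simp add: vec_eq_iff forall_3 blk_def vector_3 mat_def)
  ultimately show ?thesis by simp
qed

text \<open>Each multiplication costs 12; the summand 1 in \<open>k + 1\<close> pays for
  \<open>msym a 1\<close> in the base case.\<close>

lemma msym_power_right:
  assumes "comax a b"
  shows "near (12 * (k + 1)) (msym a (b ^ k)) (mpow (msym a b) k)"
proof (induction k)
  case 0
  show ?case using near_mono[OF msym_one_right[of a], of 12] by simp
next
  case (Suc k)
  have "near 12 (msym a (b * b ^ k)) (msym a b ** msym a (b ^ k))"
    using assms by (intro msym_mult comax_power)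
  moreover have "near (0 + 12 * (k + 1)) (msym a b ** msym a (b ^ k)) (msym a b ** mpow (msym a b) k)"
    using assms by (intro near_mult Suc near_refl msym_SL)
  ultimately have "near (12 + (0 + 12 * (k + 1))) (msym a (b * b ^ k)) (msym a b ** mpow (msym a b) k)"
    by (rule near_trans)
  then show ?case by simp
qed

text \<open>Swap, take out the exponent on the right, and swap back. The second swap happens in each
  of the \<open>k\<close> factors, for a total of \<open>5 + 12 * (k + 1) + 5 * k\<close>.\<close>

lemma msym_power_left:
  assumes "comax a b"
  shows "near (17 * (k + 1)) (msym (a ^ k) b) (mpow (msym a b) k)"
proof -
  have "near 5 (msym (a ^ k) b) (msym b (a ^ k))"
    using comax_power[OF comax_sym[OF assms]] by (rule msym_swap)
  moreover have "near (12 * (k + 1)) (msym b (a ^ k)) (mpow (msym b a) k)"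
    using comax_sym[OF assms] by (rule msym_power_right)
  moreover have "near (k * 5) (mpow (msym b a) k) (mpow (msym a b) k)"
    using assms by (intro near_mpow msym_swap)
  ultimately have "near (5 + (12 * (k + 1) + k * 5)) (msym (a ^ k) b) (mpow (msym a b) k)"
    by (blast intro: near_trans)
  then show ?thesis by (rule near_mono) simp
qed

lemma power_add_mult_cong: "\<exists>s. (b + t * a) ^ k = b ^ k + s * (a::'a::comm_ring_1)"
proof (induction k)
  case 0
  show ?case by (rule exI[of _ 0]) simp
next
  case (Suc k)
  then obtain s where "(b + t * a) ^ k = b ^ k + s * a" by blast
  then have "(b + t * a) ^ Suc k = b ^ Suc k + (t * (b ^ k + s * a) + b * s) * a"
    by (simp add: algebra_simps)
  then show ?case by blast
qed

text \<open>The error is linear in \<open>k\<close>, whereas the symbol of the \<open>k\<close>-th powers is the \<open>k\<^sup>2\<close>-th power of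
  the original one: for large \<open>k\<close> an arbitrary number of such steps becomes negligible.\<close>

lemma msym_power_add:
  assumes "comax a b"
  shows "near (36 * (k + 1)) (msym (a ^ k) ((b + t * a) ^ k)) (msym (a ^ k) (b ^ k))"
proof -
  obtain s where s: "(b + t * a) ^ k = b ^ k + s * a"
    using power_add_mult_cong by blast
  have c: "comax a (b ^ k)" "comax a (b ^ k + s * a)"
    using assms by (auto intro: comax_power comax_add)
  \<comment> \<open>The difference \<open>s * a\<close> need not be a multiple of
    \<open>a ^ k\<close>. So the left exponent is taken out first, and the shift is made in each of
    the \<open>k\<close> factors at cost 2.\<close>
  have "near (17 * (k + 1)) (msym (a ^ k) (b ^ k + s * a)) (mpow (msym a (b ^ k + s * a)) k)"
    using c by (intro msym_power_left)
  moreover have "near (k * 2) (mpow (msym a (b ^ k + s * a)) k) (mpow (msym a (b ^ k)) k)"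
    using c by (intro near_mpow msym_add)
  moreover have "near (17 * (k + 1)) (mpow (msym a (b ^ k)) k) (msym (a ^ k) (b ^ k))"
    using c by (intro near_sym[OF msym_power_left])
  ultimately have "near (17 * (k + 1) + (k * 2 + 17 * (k + 1)))
      (msym (a ^ k) (b ^ k + s * a)) (msym (a ^ k) (b ^ k))"
    by (blast intro: near_trans)
  then show ?thesis unfolding s by (rule near_mono) simp
qed

text \<open>Induction along the Euclidean algorithm: a division step is a swap and a shift, costing
  at most \<open>41 * (k + 1)\<close>. Thus \<open>L\<close> depends on \<open>a\<close> and
  \<open>b\<close> but not on \<open>k\<close>.\<close>

lemma msym_powers_near_one:
  fixes a b :: "'a::euclidean_ring"
  assumes "comax a b"
  shows "\<exists>L. \<forall>k. near (L * (k + 1)) (msym (a ^ k) (b ^ k)) (mat 1)"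
  using assms
proof (induction "euclidean_size b" arbitrary: a b rule: less_induct)
  case less
  show ?case
  proof (cases "b = 0")
    case True
    \<comment> \<open>Here \<open>a\<close> is a unit, and shifting \<open>b = 0\<close> by
      \<open>x * a\<close> gives 1.\<close>
    then obtain x where "x * a = 1" using less.prems by (auto simp: comax_def)
    then have "near (36 * (k + 1)) (msym (a ^ k) 1) (msym (a ^ k) (b ^ k))" for k
      using msym_power_add[OF less.prems, of k x] True by simp
    then have "near (36 * (k + 1) + 8) (msym (a ^ k) (b ^ k)) (mat 1)" for k
      by (rule near_trans[OF near_sym msym_one_right])
    then have "near (44 * (k + 1)) (msym (a ^ k) (b ^ k)) (mat 1)" for k
      by (rule near_mono) simp
    then show ?thesis by blast
  next
    case False
    have c: "comax b (a mod b)"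
      using comax_add[OF comax_sym[OF less.prems], of "- (a div b)"]
      by (simp add: minus_div_mult_eq_mod)
    then obtain L where L: "near (L * (k + 1)) (msym (b ^ k) ((a mod b) ^ k)) (mat 1)" for k
      using less.hyps[OF mod_size_less[OF False] c] by blast
    have "near (5 + (36 * (k + 1) + L * (k + 1))) (msym (a ^ k) (b ^ k)) (mat 1)" for k
    proof -
      have "near 5 (msym (a ^ k) (b ^ k)) (msym (b ^ k) (a ^ k))"
        using comax_sym[OF less.prems] by (intro msym_swap comax_power2)
      moreover have "near (36 * (k + 1)) (msym (b ^ k) (a ^ k)) (msym (b ^ k) ((a mod b) ^ k))"
        using msym_power_add[OF c, of k "a div b"] by simp
      ultimately show ?thesis using L[of k] by (blast intro: near_trans)
    qed
    then have "near ((L + 41) * (k + 1)) (msym (a ^ k) (b ^ k)) (mat 1)" for k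
      by (rule near_mono) (simp add: algebra_simps)
    then show ?thesis by blast
  qed
qed

lemma blk_power_comm_prods:
  fixes a b c d :: "'a::euclidean_ring"
  assumes "a * d - b * c = 1"
  shows "\<exists>k\<ge>1. mpow (blk a b c d) k \<in> comm_prods (71 * k)"
proof -
  have "d * a + (- c) * b = 1" using assms by (simp add: algebra_simps)
  then have cm: "comax a b" unfolding comax_def by blast
  then obtain L where L: "near (L * (k + 1)) (msym (a ^ k) (b ^ k)) (mat 1)" for k
    using msym_powers_near_one by blast
  \<comment> \<open>With \<open>L < k\<close> the term \<open>L * (k + 1)\<close> is below
    \<open>k * k\<close>, so the exponent \<open>k * k\<close> absorbs the dependence on the matrix
    and leaves a universal constant.\<close>
  define k where "k = Suc L"
  have 1: "near (k * k * 1) (mpow (blk a b c d) (k * k)) (mpow (msym a b) (k * k))"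
    using assms by (intro near_mpow near_blk_msym)
  have 2: "near (k * (12 * (k + 1))) (mpow (msym a b) (k * k)) (mpow (msym a (b ^ k)) k)"
    unfolding mpow_mult using cm by (intro near_mpow near_sym[OF msym_power_right])
  have 3: "near (17 * (k + 1)) (mpow (msym a (b ^ k)) k) (msym (a ^ k) (b ^ k))"
    using cm by (intro near_sym[OF msym_power_left] comax_power)
  have "near (k * k * 1 + (k * (12 * (k + 1)) + (17 * (k + 1) + L * (k + 1))))
      (mpow (blk a b c d) (k * k)) (mat 1)"
    by (rule near_trans[OF 1 near_trans[OF 2 near_trans[OF 3 L]]])
  then have "near (71 * (k * k)) (mpow (blk a b c d) (k * k)) (mat 1)"
    by (rule near_mono) (simp add: k_def algebra_simps)
  then show ?thesis
    unfolding near_one_iff by (intro exI[of _ "k * k"]) (auto simp: k_def)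
qed

subsection \<open>Block embeddings\<close>

text \<open>Extension by the identity along an injection of index sets; index types carry no order
  that would single out leading coordinates.\<close>

definition block_embed :: "('m \<Rightarrow> 'n) \<Rightarrow> 'a::comm_ring_1^'m^'m \<Rightarrow> 'a^'n^'n" where
  "block_embed f A = (\<chi> i j. if i \<in> range f \<and> j \<in> range f then A$(inv f i)$(inv f j) else mat 1$i$j)"

lemma block_embed_range [simp]: "inj f \<Longrightarrow> block_embed f A$(f i)$(f j) = A$i$j"
  by (simp add: block_embed_def)

lemma block_embed_outside: "i \<notin> range f \<or> j \<notin> range f \<Longrightarrow> block_embed f A$i$j = mat 1$i$j"
  by (auto simp: block_embed_def)

lemma block_embed_one [simp]: "inj f \<Longrightarrow> block_embed f (mat 1) = mat 1"
  by (auto simp: block_embed_def vec_eq_iff mat_def dest: injD)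

lemma block_embed_mult:
  assumes "inj f"
  shows "block_embed f (A ** B) = block_embed f A ** block_embed f B"
proof -
  have "block_embed f (A ** B)$i$j = (block_embed f A ** block_embed f B)$i$j" for i j
  proof (cases "i \<in> range f")
    case True
    then obtain i' where i: "i = f i'" by auto
    have "(block_embed f A ** block_embed f B)$i$j = (\<Sum>k\<in>UNIV. block_embed f A$i$k * block_embed f B$k$j)"
      by (simp add: matrix_matrix_mult_def)
    also have "\<dots> = (\<Sum>k\<in>range f. block_embed f A$i$k * block_embed f B$k$j)"
      using True by (intro sum.mono_neutral_right) (auto simp: block_embed_outside mat_def)
    also have "\<dots> = (\<Sum>k\<in>UNIV. A$i'$k * block_embed f B$(f k)$j)"
      using assms by (simp add: sum.reindex i)
    also have "\<dots> = block_embed f (A ** B)$i$j"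
    proof (cases "j \<in> range f")
      case True
      then show ?thesis using assms by (auto simp: i matrix_matrix_mult_def)
    next
      case False
      then have "f k \<noteq> j" for k by auto
      then show ?thesis using False by (simp add: i block_embed_outside mat_def)
    qed
    finally show ?thesis ..
  next
    case False
    then have "(block_embed f A ** block_embed f B)$i$j = (mat 1 ** block_embed f B)$i$j"
      unfolding matrix_matrix_mult_def by (simp add: block_embed_outside)
    then show ?thesis using False by (simp add: block_embed_outside)
  qed
  then show ?thesis by (simp add: vec_eq_iff)
qed

text \<open>In the Leibniz formula a permutation moving an index outside \<open>range f\<close>
  meets a zero entry. The others permute \<open>range f\<close> and correspond, with equal sign, to
  permutations of the smaller index set.\<close>

lemma det_block_embed:
  fixes f :: "'m::finite \<Rightarrow> 'n::finite" and A :: "'a::comm_ring_1^'m^'m"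
  assumes f: "inj f"
  shows "det (block_embed f A) = det A"
proof -
  let ?h = "map_permutation UNIV f" and ?h' = "map_permutation (range f) (inv f)"
  let ?t = "\<lambda>p. of_int (sign p) * (\<Prod>i\<in>UNIV. block_embed f A$i$p i)"
  have bij: "bij_betw f UNIV (range f)" using f by (simp add: bij_betw_def)
  have bij': "bij_betw (inv f) (range f) UNIV"
    using f by (metis bij bij_betw_inv_into)
  have "det (block_embed f A) = (\<Sum>p | p permutes UNIV. ?t p)"
    by (simp add: det_def)
  also have "\<dots> = (\<Sum>p | p permutes range f. ?t p)"
  proof (intro sum.mono_neutral_right ballI)
    fix p assume p: "p \<in> {p. p permutes UNIV} - {p. p permutes range f}"
    then have "\<exists>i. i \<notin> range f \<and> p i \<noteq> i"
      unfolding permutes_def by blast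
    then obtain i where "i \<notin> range f" "p i \<noteq> i" by blast
    then have "block_embed f A$i$p i = 0"
      by (simp add: block_embed_outside mat_def)
    then have "(\<Prod>i\<in>UNIV. block_embed f A$i$p i) = 0"
      by (auto intro!: prod_zero)
    then show "?t p = 0" by simp
  qed (auto simp: finite_permutations intro: permutes_subset)
  also have "\<dots> = (\<Sum>p | p permutes (UNIV :: 'm set). of_int (sign p) * (\<Prod>i\<in>UNIV. A$i$p i))"
  proof (rule sum.reindex_bij_witness[of _ ?h ?h'])
    fix p assume "p \<in> {p. p permutes (UNIV :: 'm set)}"
    then have p: "p permutes UNIV" by simp
    show "?h' (?h p) = p"
      using f by (intro map_permutation_compose_inv[OF bij p]) simp
    show "?h p \<in> {p. p permutes range f}"
      using map_permutation_permutes[OF bij p] by simp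
  next
    fix p assume "p \<in> {p. p permutes range f}"
    then have p: "p permutes range f" by simp
    show eq: "?h (?h' p) = p"
      by (intro map_permutation_compose_inv[OF bij' p]) (auto simp: f)
    show p': "?h' p \<in> {p. p permutes UNIV}"
      using map_permutation_permutes[OF bij' p] by simp
    have sign: "sign p = sign (?h' p)"
      using sign_map_permutation[of f UNIV "?h' p"] f p' eq by simp
    have pf: "p (f i) = f (?h' p i)" for i
      using map_permutation_apply[OF f, of i "?h' p"] eq by simp
    have "(\<Prod>i\<in>UNIV. block_embed f A$i$p i) = (\<Prod>i\<in>range f. block_embed f A$i$p i)"
      using p by (intro prod.mono_neutral_right) (auto simp: block_embed_outside mat_def permutes_def)
    also have "\<dots> = (\<Prod>i\<in>UNIV. A$i$?h' p i)"
      using f by (simp add: prod.reindex pf)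
    finally show "of_int (sign (?h' p)) * (\<Prod>i\<in>UNIV. A$i$?h' p i) = ?t p"
      using sign by simp
  qed
  finally show ?thesis by (simp add: det_def)
qed

lemma block_embed_SL: "inj f \<Longrightarrow> A \<in> SL \<Longrightarrow> block_embed f A \<in> SL"
  by (simp add: SL_def det_block_embed)

lemma block_embed_inv: "inj f \<Longrightarrow> A \<in> SL \<Longrightarrow> block_embed f (matrix_inv A) = matrix_inv (block_embed f A)"
  by (rule matrix_inv_eqI[symmetric]) (simp_all add: block_embed_SL block_embed_mult[symmetric])

lemma block_embed_mpow: "inj f \<Longrightarrow> block_embed f (mpow g k) = mpow (block_embed f g) k"
  by (induction k) (simp_all add: block_embed_mult)

lemma block_embed_commutator_SL: "inj f \<Longrightarrow> c \<in> commutator_SL \<Longrightarrow> block_embed f c \<in> commutator_SL"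
  by (auto simp: commutator_SL_def block_embed_mult block_embed_inv)
    (metis block_embed_SL)

lemma block_embed_comm_prods: "inj f \<Longrightarrow> x \<in> comm_prods k \<Longrightarrow> block_embed f x \<in> comm_prods k"
proof (induction k arbitrary: x)
  case (Suc k)
  then show ?case
    by (auto simp: comm_prods.simps(2) block_embed_mult) (metis block_embed_commutator_SL)
qed simp

subsection \<open>Reduction to a block of size two\<close>

text \<open>The Euclidean algorithm yields a greatest common divisor as a linear combination; the
  existential form avoids choosing among associates.\<close>

lemma bezout_exists:
  fixes a b :: "'a::euclidean_ring"
  shows "\<exists>x y. x * a + y * b dvd a \<and> x * a + y * b dvd b"
proof (induction "euclidean_size b" arbitrary: a b rule: less_induct)
  case less
  show ?case
  proof (cases "b = 0")
    case True
    then show ?thesis by (intro exI[of _ 1] exI[of _ 0]) simp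
  next
    case False
    then obtain x y where xy: "x * b + y * (a mod b) dvd b" "x * b + y * (a mod b) dvd a mod b"
      using less.hyps[OF mod_size_less] by blast
    let ?g = "x * b + y * (a mod b)"
    have "?g dvd (a div b) * b + a mod b"
      using xy by (intro dvd_add dvd_mult)
    then have "?g dvd a" by simp
    moreover have "?g = y * a + (x - y * (a div b)) * b"
      by (simp add: minus_div_mult_eq_mod[symmetric] algebra_simps)
    ultimately show ?thesis using xy(1) by (intro exI[of _ y] exI[of _ "x - y * (a div b)"]) simp
  qed
qed

lemma comax_iff_unit: "comax a b \<longleftrightarrow> (\<exists>x y. is_unit (x * a + y * b))"
proof
  assume "\<exists>x y. is_unit (x * a + y * b)"
  then obtain x y z where "1 = (x * a + y * b) * z" by (auto elim: dvdE)
  then have "(x * z) * a + (y * z) * b = 1" by (simp add: algebra_simps)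
  then show "comax a b" unfolding comax_def by blast
next
  assume "comax a b"
  then obtain x y where "x * a + y * b = 1" by (auto simp: comax_def)
  then have "is_unit (x * a + y * b)" by simp
  then show "\<exists>x y. is_unit (x * a + y * b)" by blast
qed

lemma comax_dvd:
  assumes "comax a b" "c dvd b"
  shows "comax a c"
proof -
  obtain x y z where "x * a + y * b = 1" "b = c * z"
    using assms by (auto simp: comax_def)
  then have "x * a + (y * z) * c = 1" by (simp add: algebra_simps)
  then show ?thesis unfolding comax_def by blast
qed

text \<open>Separates the part of \<open>a\<close> built from divisors of \<open>b\<close> without
  prime factorization: common divisors with \<open>b\<close> are split off repeatedly, and the
  euclidean size drops while they are nonunits.\<close>

lemma ex_coprime_part:
  fixes a b :: "'a::euclidean_ring"
  assumes "a \<noteq> 0"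
  shows "\<exists>s t k. a = s * t \<and> comax t b \<and> s dvd b ^ k"
  using assms
proof (induction "euclidean_size a" arbitrary: a rule: less_induct)
  case less
  obtain x y where g: "x * a + y * b dvd a" "x * a + y * b dvd b"
    using bezout_exists by blast
  let ?g = "x * a + y * b"
  show ?case
  proof (cases "is_unit ?g")
    case True
    then have "comax a b" by (auto simp: comax_iff_unit)
    then show ?thesis by (intro exI[of _ 1] exI[of _ a] exI[of _ 0]) simp
  next
    case False
    obtain a' where a': "a = ?g * a'" using g(1) by (rule dvdE)
    then have nz: "?g \<noteq> 0" "a' \<noteq> 0" using less.prems by auto
    have "euclidean_size a' < euclidean_size a"
      using euclidean_size_times_nonunit[OF nz False] a' by simp
    then obtain s t k where st: "a' = s * t" "comax t b" "s dvd b ^ k"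
      using less.hyps nz(2) by blast
    have "a = (?g * s) * t" using a' st(1) by (simp add: mult.assoc)
    moreover have "?g * s dvd b ^ Suc k" using g(2) st(3) by (simp add: mult_dvd_mono)
    ultimately show ?thesis using st(2) by blast
  qed
qed

text \<open>The shift \<open>t\<close> is the part of \<open>a\<close> coprime to \<open>b\<close>.
  Modulo \<open>t\<close> the new entry is \<open>b\<close>, hence coprime to \<open>t\<close>;
  coprimality to the other part \<open>s\<close> is the work.\<close>

lemma comax_shift_exists:
  fixes a b c :: "'a::euclidean_ring"
  assumes "a \<noteq> 0" "u * a + v * b + w * c = 1"
  shows "\<exists>t. comax a (b + t * c)"
proof -
  obtain s t k where st: "a = s * t" "comax t b" "s dvd b ^ k"
    using ex_coprime_part[OF assms(1)] by blast
  let ?e = "b + t * c"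
  have te: "comax t ?e"
    using comax_add[OF st(2), of c] by (simp add: mult.commute)
  obtain x y where g: "x * s + y * ?e dvd s" "x * s + y * ?e dvd ?e"
    using bezout_exists by blast
  define g where "g = x * s + y * ?e"
  \<comment> \<open>\<open>h\<close> is a common divisor of \<open>g\<close> and \<open>b\<close>.
    It divides \<open>t * c\<close> and is coprime to \<open>t\<close>, so it divides
    \<open>c\<close>; dividing \<open>a\<close>, \<open>b\<close> and \<open>c\<close>, it is a
    unit.\<close>
  obtain x' y' where h: "x' * g + y' * b dvd g" "x' * g + y' * b dvd b"
    using bezout_exists by blast
  define h where "h = x' * g + y' * b"
  have "h dvd ?e" "h dvd b" using h g by (auto simp: h_def g_def intro: dvd_trans)
  then have htc: "h dvd t * c" by (simp add: dvd_add_right_iff)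
  have "comax t h" using st(2) \<open>h dvd b\<close> by (rule comax_dvd)
  then obtain p q where "p * t + q * h = 1" by (auto simp: comax_def)
  then have "c = (p * t + q * h) * c" by simp
  then have "c = p * (t * c) + (q * c) * h" by (simp add: algebra_simps)
  moreover have "h dvd p * (t * c) + (q * c) * h" using htc by simp
  ultimately have "h dvd c" by simp
  moreover have "h dvd a" using h(1) g(1) by (auto simp: st(1) h_def g_def intro: dvd_trans)
  ultimately have "h dvd u * a + v * b + w * c"
    using \<open>h dvd b\<close> by (intro dvd_add dvd_mult)
  then have "is_unit h" using assms(2) by simp
  then have "comax g b" by (auto simp: comax_iff_unit h_def)
  \<comment> \<open>Since \<open>g\<close> divides \<open>b ^ k\<close> and is also coprime to it,
    \<open>g\<close> is a unit.\<close>
  then have "comax g (b ^ k)" by (rule comax_power)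
  moreover have "g dvd b ^ k" using g(1) st(3) by (auto simp: g_def intro: dvd_trans)
  ultimately have "comax g g" by (rule comax_dvd)
  then obtain m n where "m * g + n * g = 1" by (auto simp: comax_def)
  then have "1 = g * (m + n)" by (simp add: algebra_simps)
  then have "is_unit g" by (rule dvdI)
  then have "comax s ?e" by (auto simp: comax_iff_unit g_def)
  then have "comax ?e (s * t)" by (intro comax_mult comax_sym[of s] comax_sym[OF te])
  then show ?thesis unfolding st(1) by (intro exI, rule comax_sym)
qed

lemma comax_shift2_exists:
  fixes a b c :: "'a::euclidean_ring"
  assumes "u * a + v * b + w * c = 1"
  shows "\<exists>s t. comax (a + s * c) (b + t * c)"
proof (cases "a = 0")
  case False
  then obtain t where "comax a (b + t * c)" using comax_shift_exists assms by blast
  then have "comax (a + 0 * c) (b + t * c)" by simp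
  then show ?thesis by blast
next
  case a: True
  show ?thesis
  proof (cases "b = 0")
    case False
    have "v * b + u * a + w * c = 1" using assms by (simp add: add.commute)
    then obtain s where "comax b (a + s * c)" using comax_shift_exists[OF False] by blast
    then have "comax (a + s * c) (b + 0 * c)" using comax_sym by simp
    then show ?thesis by blast
  next
    case True
    \<comment> \<open>With \<open>a = b = 0\<close> the hypothesis gives \<open>w * c = 1\<close>,
      so both entries become 1.\<close>
    have "comax (a + w * c) (b + w * c)" using a True assms by simp
    then show ?thesis by blast
  qed
qed

section \<open>Clearing rows and columns\<close>

definition supported :: "'n set \<Rightarrow> 'a::comm_ring_1^'n^'n \<Rightarrow> bool" where
  "supported S A \<longleftrightarrow> (\<forall>i j. i \<notin> S \<or> j \<notin> S \<longrightarrow> A$i$j = mat 1$i$j)"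

text \<open>For \<open>p \<notin> J\<close> this bundles elementary matrices: on the right it adds
  multiples of the columns in \<open>J\<close> to column \<open>p\<close>, on the left multiples of
  row \<open>p\<close> to the rows in \<open>J\<close>.\<close>

definition col_elem :: "'n \<Rightarrow> 'n set \<Rightarrow> ('n \<Rightarrow> 'a) \<Rightarrow> 'a::comm_ring_1^'n^'n" where
  "col_elem p J v = (\<chi> i j. mat 1$i$j + (if j = p \<and> i \<in> J then v i else 0))"

definition row_elem :: "'n \<Rightarrow> 'n set \<Rightarrow> ('n \<Rightarrow> 'a) \<Rightarrow> 'a::comm_ring_1^'n^'n" where
  "row_elem p J v = (\<chi> i j. mat 1$i$j + (if i = p \<and> j \<in> J then v j else 0))"

lemma supported_mult:
  assumes "supported S A" "supported S B"
  shows "supported S (A ** B)"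
  unfolding supported_def
proof (intro allI impI)
  fix i j assume "i \<notin> S \<or> j \<notin> S"
  then show "(A ** B)$i$j = mat 1$i$j"
  proof
    assume i: "i \<notin> S"
    then have "(A ** B)$i$j = (mat 1 ** B)$i$j"
      using assms(1) unfolding matrix_matrix_mult_def by (simp add: supported_def)
    then show ?thesis using assms(2) i by (simp add: supported_def)
  next
    assume j: "j \<notin> S"
    then have "(A ** B)$i$j = (A ** mat 1)$i$j"
      using assms(2) unfolding matrix_matrix_mult_def by (simp add: supported_def)
    then show ?thesis using assms(1) j by (simp add: supported_def)
  qed
qed

lemma supported_col_elem: "p \<in> S \<Longrightarrow> J \<subseteq> S \<Longrightarrow> supported S (col_elem p J v)"
  by (auto simp: supported_def col_elem_def)

lemma mult_col_elem:
  "(A ** col_elem p J v)$i$j = A$i$j + (if j = p then \<Sum>m\<in>J. A$i$m * v m else 0)"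
proof -
  have "(A ** col_elem p J v)$i$j
      = (A ** mat 1)$i$j + (\<Sum>m\<in>UNIV. A$i$m * (if j = p \<and> m \<in> J then v m else 0))"
    unfolding matrix_matrix_mult_def col_elem_def by (simp add: distrib_left sum.distrib)
  also have "(\<Sum>m\<in>UNIV. A$i$m * (if j = p \<and> m \<in> J then v m else 0))
      = (\<Sum>m\<in>J. A$i$m * (if j = p then v m else 0))"
    by (rule sum.mono_neutral_cong_right) auto
  finally show ?thesis by simp
qed

lemma col_elem_mult:
  "(col_elem p J v ** A)$i$j = A$i$j + (if i \<in> J then v i * A$p$j else 0)"
  by (cases "i \<in> J")
    (simp_all add: col_elem_def matrix_matrix_mult_def mat_def distrib_right sum.distrib
      if_distrib[of "\<lambda>z. z * _"] cong: if_cong)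

lemma mult_row_elem:
  "(A ** row_elem p J v)$i$j = A$i$j + (if j \<in> J then A$i$p * v j else 0)"
  by (cases "j \<in> J")
    (simp_all add: row_elem_def matrix_matrix_mult_def mat_def distrib_left sum.distrib
      if_distrib[of "\<lambda>z. _ * z"] if_distrib[of "\<lambda>z. z * _"] cong: if_cong)

lemma col_elem_comm_prods:
  fixes J :: "'n::finite set"
  assumes "p \<notin> J" "CARD('n) \<ge> 3"
  shows "col_elem p J v \<in> comm_prods (CARD('n))"
proof -
  have "finite J" by simp
  then have "col_elem p J v \<in> comm_prods (card J)"
    using assms(1)
  proof (induction J rule: finite_induct)
    case empty
    have "col_elem p {} v = mat 1" by (simp add: col_elem_def vec_eq_iff)
    then show ?case by simp
  next
    case (insert m J)
    have "col_elem p (insert m J) v = elem m p (v m) ** col_elem p J v"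
      using insert by (auto simp: vec_eq_iff elem_mult) (auto simp: col_elem_def mat_def)
    moreover have "elem m p (v m) \<in> comm_prods 1"
      using insert assms(2) by (intro elem_comm_prods) auto
    ultimately show ?case
      using comm_prods_mult[of _ 1 "col_elem p J v" "card J"] insert by simp
  qed
  then show ?thesis by (rule comm_prods_mono) (simp add: card_mono)
qed

lemma col_elem_SL: "(p :: 'n::finite) \<notin> J \<Longrightarrow> CARD('n) \<ge> 3 \<Longrightarrow> col_elem p J v \<in> SL"
  by (rule comm_prods_subset[OF col_elem_comm_prods])

lemma row_elem_comm_prods:
  fixes J :: "'n::finite set"
  assumes "p \<notin> J" "CARD('n) \<ge> 3"
  shows "row_elem p J v \<in> comm_prods (CARD('n))"
proof -
  have "finite J" by simp
  then have "row_elem p J v \<in> comm_prods (card J)"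
    using assms(1)
  proof (induction J rule: finite_induct)
    case empty
    have "row_elem p {} v = mat 1" by (simp add: row_elem_def vec_eq_iff)
    then show ?case by simp
  next
    case (insert m J)
    have "row_elem p (insert m J) v = elem p m (v m) ** row_elem p J v"
      using insert by (auto simp: vec_eq_iff elem_mult) (auto simp: row_elem_def mat_def)
    moreover have "elem p m (v m) \<in> comm_prods 1"
      using insert assms(2) by (intro elem_comm_prods) auto
    ultimately show ?case
      using comm_prods_mult[of _ 1 "row_elem p J v" "card J"] insert by simp
  qed
  then show ?thesis by (rule comm_prods_mono) (simp add: card_mono)
qed

lemma SL_row_unimodular:
  fixes g :: "'a::comm_ring_1^'n^'n"
  assumes "g \<in> SL"
  shows "\<exists>x. (\<Sum>j\<in>UNIV. g$k$j * x j) = 1"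
proof -
  have "(g ** matrix_inv g)$k$k = 1" using assms by (simp add: mat_def)
  then show ?thesis unfolding matrix_matrix_mult_def by auto
qed

text \<open>The stable range condition makes two entries of row \<open>k\<close> comaximal, which
  allows a pivot 1 at \<open>(k, k)\<close>; then column and row \<open>k\<close> are cleared. Five
  bundled operations are used.\<close>

lemma remove_index:
  fixes g :: "'a::euclidean_ring^'n^'n"
  assumes n: "CARD('n) \<ge> 3" and T: "k \<notin> T" "p \<in> T" "q \<in> T" "p \<noteq> q"
    and g: "g \<in> SL" "supported (insert k T) g"
  shows "\<exists>h\<in>SL. supported T h \<and> near (5 * CARD('n)) g h"
proof -
  let ?S = "insert k T"
  define J where "J = ?S - {p, q}"
  have J: "p \<notin> J" "q \<notin> J" "J \<subseteq> ?S" by (auto simp: J_def)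
  obtain x where "(\<Sum>j\<in>UNIV. g$k$j * x j) = 1"
    using SL_row_unimodular[OF g(1)] by blast
  moreover have "(\<Sum>j\<in>UNIV. g$k$j * x j) = (\<Sum>j\<in>?S. g$k$j * x j)"
    using g(2) by (intro sum.mono_neutral_right) (auto simp: supported_def mat_def)
  moreover have S: "?S = insert p (insert q J)" using T by (auto simp: J_def)
  \<comment> \<open>The entries at \<open>J\<close> are merged into a single third term, so that a
    relation between three elements remains.\<close>
  ultimately have "x p * g$k$p + x q * g$k$q + 1 * (\<Sum>m\<in>J. g$k$m * x m) = 1"
    using J T(4) by (simp add: S mult.commute add.assoc)
  then obtain s t where st: "comax (g$k$p + s * (\<Sum>m\<in>J. g$k$m * x m)) (g$k$q + t * (\<Sum>m\<in>J. g$k$m * x m))"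
    using comax_shift2_exists by blast
  define g1 where "g1 = g ** col_elem p J (\<lambda>m. x m * s)"
  have g1: "g1 \<in> SL" "supported ?S g1" "near (CARD('n)) g1 g"
    unfolding g1_def using g J T
    by (auto intro!: supported_mult supported_col_elem near_mult_right col_elem_comm_prods SL_mult
        col_elem_SL n)
  define g2 where "g2 = g1 ** col_elem q J (\<lambda>m. x m * t)"
  have g2: "g2 \<in> SL" "supported ?S g2" "near (CARD('n)) g2 g1"
    unfolding g2_def using g1 J T
    by (auto intro!: supported_mult supported_col_elem near_mult_right col_elem_comm_prods SL_mult
        col_elem_SL n)
  have g1k: "g1$k$m = g$k$m" if "m \<noteq> p" for m
    using that by (simp add: g1_def mult_col_elem)
  have "g2$k$p = g$k$p + s * (\<Sum>m\<in>J. g$k$m * x m)"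
    using T(4) by (simp add: g2_def mult_col_elem g1_def sum_distrib_left algebra_simps)
  moreover have "g1$k$m = g$k$m" if "m \<in> J" for m
    using that J(1) by (intro g1k) auto
  then have "(\<Sum>m\<in>J. g1$k$m * (x m * t)) = (\<Sum>m\<in>J. g$k$m * (x m * t))"
    by simp
  then have "g2$k$q = g$k$q + t * (\<Sum>m\<in>J. g$k$m * x m)"
    using T(4) g1k[of q] by (simp add: g2_def mult_col_elem sum_distrib_left algebra_simps)
  ultimately obtain u v where uv: "u * g2$k$p + v * g2$k$q = 1"
    using st by (auto simp: comax_def)
  have kpq: "k \<notin> {p, q}" using T by auto
  \<comment> \<open>The combination of columns \<open>p\<close> and \<open>q\<close> with value 1 in
    row \<open>k\<close>, scaled by \<open>1 - g2$k$k\<close>, turns the diagonal entry into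
    1.\<close>
  define g3 where "g3 = g2 ** col_elem k {p, q} (\<lambda>m. (if m = p then u else v) * (1 - g2$k$k))"
  have g3: "g3 \<in> SL" "supported ?S g3" "near (CARD('n)) g3 g2"
    unfolding g3_def using g2 T kpq
    by (auto intro!: supported_mult supported_col_elem near_mult_right col_elem_comm_prods SL_mult
        col_elem_SL n)
  have "g3$k$k = g2$k$k + (u * g2$k$p + v * g2$k$q) * (1 - g2$k$k)"
    using T(4) by (simp add: g3_def mult_col_elem algebra_simps)
  then have g3k: "g3$k$k = 1" using uv by simp
  define g4 where "g4 = col_elem k T (\<lambda>i. - g3$i$k) ** g3"
  have g4: "g4 \<in> SL" "supported ?S g4" "near (CARD('n)) g4 g3"
    unfolding g4_def using g3 T(1)
    by (auto intro!: supported_mult supported_col_elem near_mult_left col_elem_comm_prods SL_mult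
        col_elem_SL n)
  have g4k: "g4$i$k = mat 1$i$k" for i
    using g3k T(1) g3(2) by (auto simp: g4_def col_elem_mult supported_def mat_def)
  \<comment> \<open>Row \<open>k\<close> is overwritten outright. Since column \<open>k\<close> is
    already trivial, \<open>h ** ?W = g4\<close>, which gives both the determinant of
    \<open>h\<close> and its distance from \<open>g4\<close>.\<close>
  define h :: "'a^'n^'n" where "h = (\<chi> i j. if i = k then mat 1$k$j else g4$i$j)"
  let ?W = "row_elem k T (\<lambda>j. g4$k$j)"
  have W: "?W \<in> comm_prods (CARD('n))" by (rule row_elem_comm_prods[OF T(1) n])
  have "h ** ?W = g4"
    using g4k g4(2) T(1) by (auto simp: vec_eq_iff mult_row_elem h_def mat_def supported_def)
  moreover have "det ?W = 1" using comm_prods_subset[OF W] by (simp add: SL_def)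
  ultimately have h: "h \<in> SL"
    using g4(1) det_mul[of h ?W] by (simp add: SL_def)
  have "near (CARD('n)) g4 h"
    using near_mult_right[OF W h] \<open>h ** ?W = g4\<close> by simp
  from near_trans[OF near_sym[OF g1(3)] near_trans[OF near_sym[OF g2(3)]
      near_trans[OF near_sym[OF g3(3)] near_trans[OF near_sym[OF g4(3)] this]]]]
  have "near (5 * CARD('n)) g h" by (rule near_mono) simp
  moreover have "supported T h"
    unfolding supported_def
  proof (intro allI impI)
    fix i j assume ij: "i \<notin> T \<or> j \<notin> T"
    show "h$i$j = mat 1$i$j"
    proof (cases "i = k \<or> j = k")
      case True
      then show ?thesis using g4k by (auto simp: h_def)
    next
      case False
      then have "g4$i$j = mat 1$i$j" using ij g4(2) unfolding supported_def by blast
      then show ?thesis using False by (simp add: h_def)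
    qed
  qed
  ultimately show ?thesis using h by (intro bexI[of _ h]) auto
qed

text \<open>Indices outside the pair are removed one at a time; each removal has a cost independent
  of the matrix, hence so is \<open>C\<close>.\<close>

lemma reduce_to_pair:
  fixes p q :: "'n::finite"
  assumes n: "CARD('n) \<ge> 3" and "p \<noteq> q"
  shows "\<exists>C. \<forall>g \<in> (SL :: ('a::euclidean_ring^'n^'n) set).
    \<exists>h\<in>SL. supported {p, q} h \<and> near C g h"
proof -
  have *: "\<exists>C. \<forall>g \<in> (SL :: ('a^'n^'n) set). supported ({p, q} \<union> T) g \<longrightarrow>
      (\<exists>h\<in>SL. supported {p, q} h \<and> near C g h)" if "finite T" "T \<inter> {p, q} = {}" for T
    using that
  proof (induction T rule: finite_induct)
    case empty
    show ?case by (rule exI[of _ 0]) auto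
  next
    case (insert k T)
    then obtain C where C: "\<And>g :: 'a^'n^'n. g \<in> SL \<Longrightarrow> supported ({p, q} \<union> T) g \<Longrightarrow>
        \<exists>h\<in>SL. supported {p, q} h \<and> near C g h"
      by blast
    have "\<exists>h\<in>SL. supported {p, q} h \<and> near (5 * CARD('n) + C) g h"
      if g: "g \<in> SL" "supported ({p, q} \<union> insert k T) g" for g :: "'a^'n^'n"
    proof -
      have "supported (insert k ({p, q} \<union> T)) g" using g(2) by (simp add: insert_commute)
      then obtain g' where g': "g' \<in> SL" "supported ({p, q} \<union> T) g'" "near (5 * CARD('n)) g g'"
        using remove_index[OF n, of k "{p, q} \<union> T" p q g] insert assms g(1) by auto
      then show ?thesis using C[OF g'(1,2)] near_trans[OF g'(3)] by blast
    qed
    then show ?case by blast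
  qed
  have "{p, q} \<union> (UNIV - {p, q}) = UNIV" by auto
  then show ?thesis using *[of "UNIV - {p, q}"] by (auto simp: supported_def)
qed

text \<open>The index \<open>f 3\<close> carries only the identity; including it moves the pair into
  dimension 3, where the symbols live.\<close>

lemma supported_pair_blk:
  fixes f :: "3 \<Rightarrow> 'n::finite" and h :: "'a::comm_ring_1^'n^'n"
  assumes f: "inj f" and h: "supported {f 1, f 2} h"
  shows "h = block_embed f (blk (h$f 1$f 1) (h$f 1$f 2) (h$f 2$f 1) (h$f 2$f 2))" (is "h = block_embed f ?B")
proof -
  have "h$i$j = block_embed f ?B$i$j" for i j
  proof (cases "i \<in> range f \<and> j \<in> range f")
    case True
    then obtain i' j' where ij: "i = f i'" "j = f j'" by auto
    have [simp]: "f a = f b \<longleftrightarrow> a = b" for a b using f by (auto dest: injD)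
    have "\<forall>a b. h$f a$f b = ?B$a$b"
      unfolding forall_3 blk_def using h by (simp add: supported_def mat_def vector_3)
    then show ?thesis unfolding ij block_embed_range[OF f] by blast
  next
    case False
    then have "i \<notin> {f 1, f 2} \<or> j \<notin> {f 1, f 2}" by auto
    then have "h$i$j = mat 1$i$j" using h unfolding supported_def by blast
    moreover have "block_embed f ?B$i$j = mat 1$i$j"
      using False by (intro block_embed_outside) auto
    ultimately show ?thesis by simp
  qed
  then show ?thesis unfolding vec_eq_iff by blast
qed

text \<open>The reduction error \<open>D\<close> is paid once per factor of the power, and 71 comes
  from the block; neither depends on \<open>g\<close>, while \<open>k\<close> may.\<close>

lemma uniform_power_comm_prods:
  assumes n: "CARD('n::finite) \<ge> 3"
  shows "\<exists>C. \<forall>g \<in> (SL :: ('a::euclidean_ring^'n^'n) set). \<exists>k\<ge>1. mpow g k \<in> comm_prods (C * k)"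
proof -
  have "\<exists>f :: 3 \<Rightarrow> 'n. inj_on f UNIV \<and> f ` UNIV \<subseteq> UNIV"
    using n by (subst inj_on_iff_card_le) auto
  then obtain f :: "3 \<Rightarrow> 'n" where f: "inj f" by blast
  then have "f 1 \<noteq> f 2" by (auto dest: injD)
  then obtain D where D: "\<And>g :: 'a^'n^'n. g \<in> SL \<Longrightarrow>
      \<exists>h\<in>SL. supported {f 1, f 2} h \<and> near D g h"
    using reduce_to_pair[OF n] by blast
  have "\<exists>k\<ge>1. mpow g k \<in> comm_prods ((D + 71) * k)" if g: "g \<in> SL" for g :: "'a^'n^'n"
  proof -
    obtain h where h: "h \<in> SL" "supported {f 1, f 2} h" "near D g h"
      using D[OF g] by blast
    obtain a b c d where hb: "h = block_embed f (blk a b c d)"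
      using supported_pair_blk[OF f h(2)] by blast
    then have "a * d - b * c = 1"
      using h(1) by (simp add: SL_def det_block_embed[OF f] det_blk)
    then obtain k where k: "k \<ge> 1" "mpow (blk a b c d) k \<in> comm_prods (71 * k)"
      using blk_power_comm_prods by blast
    then have "near (71 * k) (mpow h k) (mat 1)"
      unfolding near_one_iff hb
      using block_embed_comm_prods[OF f] by (simp flip: block_embed_mpow[OF f])
    then have "near (k * D + 71 * k) (mpow g k) (mat 1)"
      by (rule near_trans[OF near_mpow[OF h(3)]])
    then have "mpow g k \<in> comm_prods ((D + 71) * k)"
      unfolding near_one_iff by (simp add: algebra_simps)
    then show ?thesis using k(1) by blast
  qed
  then show ?thesis by blast
qed

subsection \<open>Quasi-homomorphisms and stable commutator length\<close>

lemma quasi_hom_comm_prods_bound: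
  fixes \<psi> :: "'a::comm_ring_1^'n^'n \<Rightarrow> real"
  assumes C: "\<And>g h. g \<in> SL \<Longrightarrow> h \<in> SL \<Longrightarrow> \<bar>\<psi> (g ** h) - \<psi> g - \<psi> h\<bar> \<le> C"
  shows "x \<in> comm_prods m \<Longrightarrow> \<bar>\<psi> x\<bar> \<le> C + real m * (8 * C)"
proof (induction m arbitrary: x)
  case 0
  then show ?case using C[of "mat 1" "mat 1"] by simp
next
  case (Suc m)
  have one: "\<bar>\<psi> (mat 1)\<bar> \<le> C" using C[of "mat 1" "mat 1"] by simp
  obtain y c where yc: "y \<in> comm_prods m" "c \<in> commutator_SL" "x = y ** c"
    using Suc.prems by (auto simp: comm_prods.simps(2))
  obtain g h where gh: "g \<in> SL" "h \<in> SL" "c = g ** h ** matrix_inv g ** matrix_inv h"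
    using yc(2) by (auto simp: commutator_SL_def)
  have "\<bar>\<psi> c - \<psi> (g ** h ** matrix_inv g) - \<psi> (matrix_inv h)\<bar> \<le> C"
    "\<bar>\<psi> (g ** h ** matrix_inv g) - \<psi> (g ** h) - \<psi> (matrix_inv g)\<bar> \<le> C"
    "\<bar>\<psi> (g ** h) - \<psi> g - \<psi> h\<bar> \<le> C"
    "\<bar>\<psi> (mat 1) - \<psi> g - \<psi> (matrix_inv g)\<bar> \<le> C"
    "\<bar>\<psi> (mat 1) - \<psi> h - \<psi> (matrix_inv h)\<bar> \<le> C"
    using gh C[of "g ** h ** matrix_inv g" "matrix_inv h"] C[of "g ** h" "matrix_inv g"]
      C[of g h] C[of g "matrix_inv g"] C[of h "matrix_inv h"] by simp_all
  \<comment> \<open>Splitting the four factors costs \<open>3 * C\<close>, and each pair of an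
    element and its inverse contributes at most \<open>2 * C\<close>.\<close>
  then have "\<bar>\<psi> c\<bar> \<le> 7 * C" using one unfolding abs_le_iff by linarith
  moreover have "\<bar>\<psi> x - \<psi> y - \<psi> c\<bar> \<le> C"
    using C[of y c] comm_prods_subset[OF yc(1)] commutator_SL_subset[OF yc(2)] yc(3) by simp
  ultimately show ?case
    using Suc.IH[OF yc(1)] unfolding abs_le_iff by (simp add: algebra_simps)
qed

lemma quasi_hom_mpow:
  fixes \<psi> :: "'a::comm_ring_1^'n^'n \<Rightarrow> real"
  assumes C: "\<And>g h. g \<in> SL \<Longrightarrow> h \<in> SL \<Longrightarrow> \<bar>\<psi> (g ** h) - \<psi> g - \<psi> h\<bar> \<le> C" and "g \<in> SL"
  shows "\<bar>\<psi> (mpow g k) - real k * \<psi> g\<bar> \<le> (real k + 1) * C"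
proof (induction k)
  case 0
  then show ?case using C[of "mat 1" "mat 1"] by simp
next
  case (Suc k)
  then show ?case
    using C[of g "mpow g k"] assms(2) unfolding abs_le_iff by (simp add: algebra_simps)
qed

text \<open>Both \<open>\<psi> (mpow g k) - k * \<psi> g\<close> and
  \<open>\<psi> (mpow g k)\<close> are linear in \<open>k\<close> with constants independent of
  \<open>g\<close>; division by \<open>k\<close> bounds \<open>\<psi> g\<close>.\<close>

lemma quasi_hom_bounded:
  fixes \<psi> :: "'a::euclidean_ring^'n^'n \<Rightarrow> real"
  assumes n: "CARD('n) \<ge> 3" and "quasi_hom_SL \<psi>"
  shows "\<exists>B. \<forall>g\<in>SL. \<bar>\<psi> g\<bar> \<le> B"
proof -
  obtain D where D: "\<And>g h. g \<in> SL \<Longrightarrow> h \<in> SL \<Longrightarrow> \<bar>\<psi> (g ** h) - \<psi> g - \<psi> h\<bar> \<le> D"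
    using assms(2) by (auto simp: quasi_hom_SL_def)
  obtain C where C: "\<And>g :: 'a^'n^'n. g \<in> SL \<Longrightarrow> \<exists>k\<ge>1. mpow g k \<in> comm_prods (C * k)"
    using uniform_power_comm_prods[OF n] by blast
  have D0: "D \<ge> 0" using D[of "mat 1" "mat 1"] by simp
  have "\<bar>\<psi> g\<bar> \<le> 3 * D + 8 * D * C" if g: "g \<in> SL" for g
  proof -
    obtain k where k: "k \<ge> 1" "mpow g k \<in> comm_prods (C * k)" using C[OF g] by blast
    have "real k * \<bar>\<psi> g\<bar> = \<bar>real k * \<psi> g\<bar>" by (simp add: abs_mult)
    also have "\<dots> \<le> (real k + 1) * D + (D + real (C * k) * (8 * D))"
      using quasi_hom_mpow[of \<psi> D, OF D g, of k] quasi_hom_comm_prods_bound[of \<psi> D, OF D k(2)] by linarith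
    also have "\<dots> = real k * (D + 8 * D * C) + 1 * (2 * D)"
      by (simp add: algebra_simps)
    also have "\<dots> \<le> real k * (D + 8 * D * C) + real k * (2 * D)"
      using k(1) D0 by (intro add_left_mono mult_right_mono) auto
    also have "\<dots> = real k * (3 * D + 8 * D * C)" by (simp add: algebra_simps)
    finally show ?thesis using k(1) by simp
  qed
  then show ?thesis by blast
qed

section \<open>Vanishing of the stable commutator length\<close>

lemma cl_SL_le: "g \<in> comm_prods k \<Longrightarrow> cl_SL g \<le> k"
  unfolding cl_SL_def by (rule Least_le)

text \<open>Applying the uniform bound to \<open>mpow g m\<close> shows that the exponent
  \<open>m * K\<close> needs only \<open>C * K\<close> commutators. So the growth rate is at most
  \<open>C / m\<close> for every positive \<open>m\<close>.\<close>

lemma scl_zero: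
  fixes g :: "'a::euclidean_ring^'n^'n"
  assumes n: "CARD('n) \<ge> 3" and "g \<in> comm_subgroup_SL"
  shows "(\<lambda>k. real (cl_SL (mpow g k)) / real k) \<longlonglongrightarrow> 0"
proof -
  obtain j where j: "g \<in> comm_prods j" using assms(2) by (auto simp: comm_subgroup_SL_def)
  have g: "g \<in> SL" using j by (rule comm_prods_subset)
  obtain C where C: "\<And>g :: 'a^'n^'n. g \<in> SL \<Longrightarrow> \<exists>k\<ge>1. mpow g k \<in> comm_prods (C * k)"
    using uniform_power_comm_prods[OF n] by blast
  show ?thesis
  proof (rule LIMSEQ_I)
    fix e :: real assume e: "e > 0"
    obtain m where m: "real C / (e / 2) < real m" using reals_Archimedean2 by blast
    then have m0: "m > 0" using e by (cases m) (auto simp: divide_less_0_iff)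
    have Cm: "real C / real m < e / 2" using m m0 e by (simp add: field_simps)
    obtain K where K: "K \<ge> 1" "mpow g (m * K) \<in> comm_prods (C * K)"
      using C[OF mpow_SL[OF g], of m] by (auto simp: mpow_mult)
    define d where "d = m * K"
    have d0: "d > 0" using m0 K(1) by (simp add: d_def)
    have bound: "real (cl_SL (mpow g k)) \<le> real k * (real C / real m) + real (d * j)" for k
    proof -
      \<comment> \<open>Division of \<open>k\<close> by \<open>d\<close>: full blocks use the good
        bound, and the remainder costs at most \<open>d * j\<close>, which is independent of
        \<open>k\<close>.\<close>
      have "mpow g k = mpow (mpow g d) (k div d) ** mpow g (k mod d)"
        by (simp flip: mpow_mult mpow_add)
      moreover have "mpow (mpow g d) (k div d) \<in> comm_prods (k div d * (C * K))"
        using K(2) by (intro comm_prods_mpow) (simp add: d_def)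
      moreover have "mpow g (k mod d) \<in> comm_prods (d * j)"
        using comm_prods_mpow[OF j, of "k mod d"]
        by (rule comm_prods_mono) (use d0 in \<open>simp add: less_imp_le\<close>)
      ultimately have "cl_SL (mpow g k) \<le> k div d * (C * K) + d * j"
        by (metis cl_SL_le comm_prods_mult)
      then have "real (cl_SL (mpow g k)) \<le> real (k div d * (C * K) + d * j)"
        by (rule of_nat_mono)
      also have "\<dots> = real (k div d * d) * (real C / real m) + real (d * j)"
        using m0 by (simp add: d_def field_simps)
      also have "\<dots> \<le> real k * (real C / real m) + real (d * j)"
        by (intro add_right_mono mult_right_mono of_nat_mono) auto
      finally show ?thesis .
    qed
    \<comment> \<open>Beyond \<open>N\<close> the remainder term contributes less than
      \<open>e / 2\<close> per unit of \<open>k\<close>.\<close>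
    obtain N where N: "real (d * j) / (e / 2) < real N" using reals_Archimedean2 by blast
    show "\<exists>N. \<forall>k\<ge>N. norm (real (cl_SL (mpow g k)) / real k - 0) < e"
    proof (intro exI allI impI)
      fix k assume k: "k \<ge> Suc N"
      have "real (d * j) < real N * (e / 2)" using N e by (simp add: divide_less_eq)
      also have "\<dots> \<le> real k * (e / 2)" using k e by (intro mult_right_mono) auto
      finally have "real (d * j) < real k * (e / 2)" .
      moreover have "real k * (real C / real m) \<le> real k * (e / 2)"
        using Cm by (intro mult_left_mono) auto
      ultimately have "real (cl_SL (mpow g k)) < real k * e"
        using bound[of k] by linarith
      then show "norm (real (cl_SL (mpow g k)) / real k - 0) < e"
        using k by (simp add: divide_less_eq mult.commute)
    qed
  qed
qed

theorem theorem1p4: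
  fixes dummy :: "'a::euclidean_ring^'n^'n"
  assumes "CARD('n) \<ge> 6"
  shows "(\<forall>\<psi> :: 'a^'n^'n \<Rightarrow> real. quasi_hom_SL \<psi> \<longrightarrow>
            (\<exists>B. \<forall>g\<in>SL. \<bar>\<psi> g\<bar> \<le> B))
       \<and> (\<forall>g :: 'a^'n^'n. g \<in> comm_subgroup_SL \<longrightarrow>
            (\<lambda>k. real (cl_SL (mpow g k)) / real k) \<longlonglongrightarrow> 0)"
proof -
  have "CARD('n) \<ge> 3" using assms by simp
  then show ?thesis by (blast intro: quasi_hom_bounded scl_zero)
qed

end
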